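(* Let $(X,d)$ be a metric space and assume that $\delta$ is an asymmetric metric on $X$ having properties (bL) and (ic). Let $o\in X$ be a basepoint. For every normalized horofunction $\varphi\in\widehat X$, there exists $p\in{}^*X$ with $\varphi=h_p$. If $(X,d)$ is almost proper, then conversely every $h_p$, for $p\in{}^*X$, is a normalized horofunction.
   Context: An asymmetric metric on $X$ is a map $\delta:X\times X\to\mathbb R$ with $\delta(u,v)\ge0$, $\delta(u,v)=0$ iff $u=v$, and $\delta(u,w)\le\delta(u,v)+\delta(v,w)$ for all $u,v,w\in X$ (no symmetry required). (bL): there are real constants $\alpha,\beta>0$ such that $d(p,q)\le\alpha\,\delta(p,q)$ and $\delta(p,q)\le\beta\,d(p,q)$ for all $p,q\in X$. (ic): for all $p,q\in X$ and $s\in[0,\delta(p,q)]$ there is $z\in X$ with $\delta(p,q)=\delta(p,z)+\delta(z,q)$ and $\delta(p,z)=s$. The bordification $\widehat X$ is the closure of $\{\delta(p,-)+\mathbb R\mid p\in X\}$ in $C_{\mathrm{Bnd}}(X)/\mathbb R$, where $C_{\mathrm{Bnd}}(X)$ is the space of continuous real functions on $X$ that are bounded on bounded sets, with the topology of uniform convergence on bounded sets, and $\mathbb R$ denotes the constant functions. Each element of $\widehat X$ has a unique representative $\varphi$ with $\varphi(o)=0$, called a normalized horofunction; $\widehat X$ is thus identified with the closure of $\{\delta(p,-)-\delta(p,o)\mid p\in X\}$ in $\{\varphi\in C_{\mathrm{Bnd}}(X)\mid\varphi(o)=0\}$. Fix a free ultrafilter $\mu$ on a countably infinite set $J$. For a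 set $X$, ${}^*X=\prod_JX/\mu$ is the ultrapower, containing $X$ diagonally; functions $f:X\to Y$ extend to ${}^*f:{}^*X\to{}^*Y$. In the ordered field ${}^*\mathbb R$, ${}^*\mathbb R_{\mathrm{fin}}=\{r\mid |r|\le n\text{ for some }n\in\mathbb N\}$, ${}^*\mathbb R_{\mathrm{inf}}=\{r\mid |r|\le2^{-n}\text{ for all }n\in\mathbb N\}$, and $\mathrm{std}:{}^*\mathbb R_{\mathrm{fin}}\to{}^*\mathbb R_{\mathrm{fin}}/{}^*\mathbb R_{\mathrm{inf}}\cong\mathbb R$ is the standard part map. For $p\in{}^*X$ the function $h_p:X\to\mathbb R$ is $h_p(x)=\mathrm{std}({}^*\delta(p,x)-{}^*\delta(p,o))$. $(X,d)$ is almost proper if every bounded subset of $X$ is totally bounded, i.e. for every bounded $Y\subseteq X$ and $\varepsilon>0$ there is a finite set $Y_0\subseteq X$ with $Y\subseteq\bigcup_{x\in Y_0}B_\varepsilon(x)$, where $B_\varepsilon(x)=\{y\in X\mid d(x,y)<\varepsilon\}$. *)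

theory Defs
  imports "HOL-Analysis.Analysis"
begin

section \<open>Asymmetric metrics\<close>

definition asymmetric_metric :: "('a \<Rightarrow> 'a \<Rightarrow> real) \<Rightarrow> bool" where
  "asymmetric_metric \<delta> \<longleftrightarrow>
     (\<forall>u v. \<delta> u v \<ge> 0) \<and>
     (\<forall>u v. \<delta> u v = 0 \<longleftrightarrow> u = v) \<and>
     (\<forall>u v w. \<delta> u w \<le> \<delta> u v + \<delta> v w)"

definition property_bL :: "('a::metric_space \<Rightarrow> 'a \<Rightarrow> real) \<Rightarrow> bool" where
  "property_bL \<delta> \<longleftrightarrow>
     (\<exists>\<alpha> \<beta>. \<alpha> > 0 \<and> \<beta> > 0 \<and>
        (\<forall>p q. dist p q \<le> \<alpha> * \<delta> p q \<and> \<delta> p q \<le> \<beta> * dist p q))"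

definition property_ic :: "('a \<Rightarrow> 'a \<Rightarrow> real) \<Rightarrow> bool" where
  "property_ic \<delta> \<longleftrightarrow>
     (\<forall>p q. \<forall>s\<in>{0..\<delta> p q}. \<exists>z. \<delta> p q = \<delta> p z + \<delta> z q \<and> \<delta> p z = s)"

text \<open>The library fact \<open>totally_bounded_metric\<close> gives the description by finitely many
  \<open>\<epsilon>\<close>-balls, whose centres may be arbitrary points of the space.\<close>

definition almost_proper :: "'a::metric_space itself \<Rightarrow> bool" where
  "almost_proper _ \<longleftrightarrow> (\<forall>Y::'a set. bounded Y \<longrightarrow> totally_bounded Y)"


section \<open>The bordification\<close>

definition C_Bnd :: "('a::metric_space \<Rightarrow> real) set" where
  "C_Bnd = {\<phi>. continuous_on UNIV \<phi> \<and> (\<forall>B. bounded B \<longrightarrow> bounded (\<phi> ` B))}"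

text \<open>Uniform convergence on bounded sets. A single bounded set suffices for a basic
  neighbourhood, as bounded sets are closed under finite unions.\<close>

definition C_Bnd_topology :: "('a::metric_space \<Rightarrow> real) topology" where
  "C_Bnd_topology = topology (\<lambda>U. U \<subseteq> C_Bnd \<and>
     (\<forall>\<phi>\<in>U. \<exists>B \<epsilon>. bounded B \<and> \<epsilon> > 0 \<and>
        {\<psi> \<in> C_Bnd. \<forall>x\<in>B. \<bar>\<psi> x - \<phi> x\<bar> < \<epsilon>} \<subseteq> U))"

lemma openin_C_Bnd_topology:
  "openin C_Bnd_topology U \<longleftrightarrow> U \<subseteq> C_Bnd \<and>
     (\<forall>\<phi>\<in>U. \<exists>B \<epsilon>. bounded B \<and> \<epsilon> > 0 \<and>
        {\<psi> \<in> C_Bnd. \<forall>x\<in>B. \<bar>\<psi> x - \<phi> x\<bar> < \<epsilon>} \<subseteq> U)"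
proof -
  define P :: "('a \<Rightarrow> real) set \<Rightarrow> bool" where "P = (\<lambda>U. U \<subseteq> C_Bnd \<and>
     (\<forall>\<phi>\<in>U. \<exists>B \<epsilon>. bounded B \<and> \<epsilon> > 0 \<and>
        {\<psi> \<in> C_Bnd. \<forall>x\<in>B. \<bar>\<psi> x - \<phi> x\<bar> < \<epsilon>} \<subseteq> U))"
  have "P (S \<inter> T)" if "P S" "P T" for S T
    unfolding P_def
  proof (intro conjI ballI)
    show "S \<inter> T \<subseteq> C_Bnd" using that by (auto simp: P_def)
    fix \<phi> assume "\<phi> \<in> S \<inter> T"
    then obtain B \<epsilon> B' \<epsilon>' where *: "bounded B" "\<epsilon> > 0" "bounded B'" "\<epsilon>' > 0"
      "{\<psi> \<in> C_Bnd. \<forall>x\<in>B. \<bar>\<psi> x - \<phi> x\<bar> < \<epsilon>} \<subseteq> S"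
      "{\<psi> \<in> C_Bnd. \<forall>x\<in>B'. \<bar>\<psi> x - \<phi> x\<bar> < \<epsilon>'} \<subseteq> T"
      using \<open>P S\<close> \<open>P T\<close> unfolding P_def by (meson IntD1 IntD2)
    show "\<exists>B \<epsilon>. bounded B \<and> \<epsilon> > 0 \<and>
        {\<psi> \<in> C_Bnd. \<forall>x\<in>B. \<bar>\<psi> x - \<phi> x\<bar> < \<epsilon>} \<subseteq> S \<inter> T"
      by (rule exI[of _ "B \<union> B'"], rule exI[of _ "min \<epsilon> \<epsilon>'"]) (use * in auto)
  qed
  moreover have "P (\<Union>\<K>)" if "\<forall>K\<in>\<K>. P K" for \<K>
    unfolding P_def
  proof (intro conjI ballI)
    show "\<Union>\<K> \<subseteq> C_Bnd" using that by (auto simp: P_def)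
    fix \<phi> assume "\<phi> \<in> \<Union>\<K>"
    then obtain K where K: "K \<in> \<K>" "\<phi> \<in> K" by blast
    with that obtain B \<epsilon> where "bounded B" "\<epsilon> > 0"
      "{\<psi> \<in> C_Bnd. \<forall>x\<in>B. \<bar>\<psi> x - \<phi> x\<bar> < \<epsilon>} \<subseteq> K"
      unfolding P_def by meson
    with K show "\<exists>B \<epsilon>. bounded B \<and> \<epsilon> > 0 \<and>
        {\<psi> \<in> C_Bnd. \<forall>x\<in>B. \<bar>\<psi> x - \<phi> x\<bar> < \<epsilon>} \<subseteq> \<Union>\<K>"
      by blast
  qed
  ultimately have "istopology P"
    by (simp add: istopology_def)
  then have "openin (topology P) = P"
    by (rule topology_inverse')
  then show ?thesis
    unfolding C_Bnd_topology_def P_def by simp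
qed

definition mod_const :: "(('a::metric_space \<Rightarrow> real) \<times> ('a \<Rightarrow> real)) set" where
  "mod_const = {(\<phi>, \<psi>). \<phi> \<in> C_Bnd \<and> \<psi> \<in> C_Bnd \<and> (\<exists>c. \<forall>x. \<psi> x = \<phi> x + c)}"

definition const_class :: "('a::metric_space \<Rightarrow> real) \<Rightarrow> ('a \<Rightarrow> real) set" where
  "const_class \<phi> = mod_const `` {\<phi>}"

text \<open>The space \<open>C_Bnd / \<real>\<close> with the quotient topology.\<close>

definition C_Bnd_mod_const :: "('a::metric_space \<Rightarrow> real) set topology" where
  "C_Bnd_mod_const = topology (\<lambda>V. V \<subseteq> C_Bnd // mod_const \<and>
     openin C_Bnd_topology {\<phi> \<in> C_Bnd. const_class \<phi> \<in> V})"

lemma openin_C_Bnd_mod_const: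
  "openin C_Bnd_mod_const V \<longleftrightarrow> V \<subseteq> C_Bnd // mod_const \<and>
     openin C_Bnd_topology {\<phi> \<in> C_Bnd. const_class \<phi> \<in> V}"
proof -
  define P :: "('a \<Rightarrow> real) set set \<Rightarrow> bool" where "P = (\<lambda>V. V \<subseteq> C_Bnd // mod_const \<and>
     openin C_Bnd_topology {\<phi> \<in> C_Bnd. const_class \<phi> \<in> V})"
  have "P (S \<inter> T)" if "P S" "P T" for S T
  proof -
    have "{\<phi> \<in> C_Bnd. const_class \<phi> \<in> S \<inter> T} =
      {\<phi> \<in> C_Bnd. const_class \<phi> \<in> S} \<inter> {\<phi> \<in> C_Bnd. const_class \<phi> \<in> T}" by blast
    with that show ?thesis by (auto simp: P_def)
  qed
  moreover have "P (\<Union>\<K>)" if "\<forall>K\<in>\<K>. P K" for \<K>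
  proof -
    have "{\<phi> \<in> C_Bnd. const_class \<phi> \<in> \<Union>\<K>} =
      (\<Union>K\<in>\<K>. {\<phi> \<in> C_Bnd. const_class \<phi> \<in> K})" by blast
    moreover have "openin C_Bnd_topology (\<Union>K\<in>\<K>. {\<phi> \<in> C_Bnd. const_class \<phi> \<in> K})"
      using that by (intro openin_Union) (auto simp: P_def)
    ultimately show ?thesis using that unfolding P_def by auto
  qed
  ultimately have "istopology P"
    by (simp add: istopology_def)
  then have "openin (topology P) = P"
    by (rule topology_inverse')
  then show ?thesis
    unfolding C_Bnd_mod_const_def P_def by simp
qed

definition bordification :: "('a::metric_space \<Rightarrow> 'a \<Rightarrow> real) \<Rightarrow> ('a \<Rightarrow> real) set set" where
  "bordification \<delta> = C_Bnd_mod_const closure_of {const_class (\<delta> p) | p. True}"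

text \<open>The base point is called \<open>b\<close>, as \<open>o\<close> is reserved for function composition.\<close>

definition normalized_horofunction ::
    "('a::metric_space \<Rightarrow> 'a \<Rightarrow> real) \<Rightarrow> 'a \<Rightarrow> ('a \<Rightarrow> real) \<Rightarrow> bool" where
  "normalized_horofunction \<delta> b \<phi> \<longleftrightarrow>
     \<phi> \<in> C_Bnd \<and> \<phi> b = 0 \<and> const_class \<phi> \<in> bordification \<delta>"


section \<open>Ultrapowers\<close>

definition free_ultrafilter :: "'j filter \<Rightarrow> bool" where
  "free_ultrafilter \<mu> \<longleftrightarrow> \<mu> \<noteq> bot \<and>
     (\<forall>P. eventually P \<mu> \<or> eventually (\<lambda>j. \<not> P j) \<mu>) \<and>
     (\<forall>i. eventually (\<lambda>j. j \<noteq> i) \<mu>)"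

definition ultra_eq :: "'j filter \<Rightarrow> (('j \<Rightarrow> 'a) \<times> ('j \<Rightarrow> 'a)) set" where
  "ultra_eq \<mu> = {(f, g). eventually (\<lambda>j. f j = g j) \<mu>}"

text \<open>Elements of the ultrapower are equivalence classes of families. It is a set rather
  than a type since it depends on \<open>\<mu>\<close>.\<close>

definition ultrapower :: "'j filter \<Rightarrow> ('j \<Rightarrow> 'a) set set" where
  "ultrapower \<mu> = UNIV // ultra_eq \<mu>"

definition ultra_class :: "'j filter \<Rightarrow> ('j \<Rightarrow> 'a) \<Rightarrow> ('j \<Rightarrow> 'a) set" where
  "ultra_class \<mu> f = ultra_eq \<mu> `` {f}"

definition ultra_const :: "'j filter \<Rightarrow> 'a \<Rightarrow> ('j \<Rightarrow> 'a) set" where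
  "ultra_const \<mu> x = ultra_class \<mu> (\<lambda>_. x)"

text \<open>Extensions of unary and binary functions and of binary relations. On elements of the
  ultrapower, the unions below are unions of equal classes.\<close>

definition ultra_map ::
    "'j filter \<Rightarrow> ('a \<Rightarrow> 'b) \<Rightarrow> ('j \<Rightarrow> 'a) set \<Rightarrow> ('j \<Rightarrow> 'b) set" where
  "ultra_map \<mu> F A = (\<Union>f\<in>A. ultra_class \<mu> (\<lambda>j. F (f j)))"

definition ultra_map2 ::
    "'j filter \<Rightarrow> ('a \<Rightarrow> 'b \<Rightarrow> 'c) \<Rightarrow> ('j \<Rightarrow> 'a) set \<Rightarrow> ('j \<Rightarrow> 'b) set \<Rightarrow> ('j \<Rightarrow> 'c) set" where
  "ultra_map2 \<mu> F A B = (\<Union>f\<in>A. \<Union>g\<in>B. ultra_class \<mu> (\<lambda>j. F (f j) (g j)))"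

definition ultra_rel ::
    "'j filter \<Rightarrow> ('a \<Rightarrow> 'b \<Rightarrow> bool) \<Rightarrow> ('j \<Rightarrow> 'a) set \<Rightarrow> ('j \<Rightarrow> 'b) set \<Rightarrow> bool" where
  "ultra_rel \<mu> R A B \<longleftrightarrow> (\<exists>f\<in>A. \<exists>g\<in>B. eventually (\<lambda>j. R (f j) (g j)) \<mu>)"

abbreviation hyper_minus ::
    "'j filter \<Rightarrow> ('j \<Rightarrow> real) set \<Rightarrow> ('j \<Rightarrow> real) set \<Rightarrow> ('j \<Rightarrow> real) set" where
  "hyper_minus \<mu> \<equiv> ultra_map2 \<mu> (-)"

abbreviation hyper_abs :: "'j filter \<Rightarrow> ('j \<Rightarrow> real) set \<Rightarrow> ('j \<Rightarrow> real) set" where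
  "hyper_abs \<mu> \<equiv> ultra_map \<mu> abs"

abbreviation hyper_le :: "'j filter \<Rightarrow> ('j \<Rightarrow> real) set \<Rightarrow> ('j \<Rightarrow> real) set \<Rightarrow> bool" where
  "hyper_le \<mu> \<equiv> ultra_rel \<mu> (\<le>)"

definition hyper_fin :: "'j filter \<Rightarrow> ('j \<Rightarrow> real) set set" where
  "hyper_fin \<mu> = {r \<in> ultrapower \<mu>.
     \<exists>n::nat. hyper_le \<mu> (hyper_abs \<mu> r) (ultra_const \<mu> (real n))}"

definition hyper_inf :: "'j filter \<Rightarrow> ('j \<Rightarrow> real) set set" where
  "hyper_inf \<mu> = {r \<in> ultrapower \<mu>.
     \<forall>n::nat. hyper_le \<mu> (hyper_abs \<mu> r) (ultra_const \<mu> (1 / 2 ^ n))}"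

text \<open>The isomorphism of \<open>\<real>\<close> with the quotient of the finite by the infinitesimal
  hyperreals is induced by the diagonal embedding; so the standard part of a finite \<open>r\<close> is
  the unique real in its residue class. The value at infinite \<open>r\<close> is unspecified.\<close>

definition std_part :: "'j filter \<Rightarrow> ('j \<Rightarrow> real) set \<Rightarrow> real" where
  "std_part \<mu> r = (THE s. r \<in> hyper_fin \<mu> \<and> hyper_minus \<mu> r (ultra_const \<mu> s) \<in> hyper_inf \<mu>)"

definition horo ::
    "'j filter \<Rightarrow> ('a \<Rightarrow> 'a \<Rightarrow> real) \<Rightarrow> 'a \<Rightarrow> ('j \<Rightarrow> 'a) set \<Rightarrow> 'a \<Rightarrow> real" where
  "horo \<mu> \<delta> b p x = std_part \<mu>
     (hyper_minus \<mu> (ultra_map2 \<mu> \<delta> p (ultra_const \<mu> x)) (ultra_map2 \<mu> \<delta> p (ultra_const \<mu> b)))"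

end

theory Submission
  imports Defs
begin

text \<open>An element \<open>p\<close> of the ultrapower is represented by a family \<open>f\<close> of points, and \<open>h\<^sub>p\<close> is the
  pointwise limit along the ultrafilter of the normalized distance functions from \<open>f j\<close>.
  A normalized horofunction is within \<open>1 / (n + 1)\<close> on the ball of radius \<open>n\<close> of such a
  distance function; distributing these approximations over the index set by means of an
  injection into the natural numbers gives \<open>p\<close>, because a free ultrafilter contains all
  cofinite sets. Conversely, the normalized distance functions are uniformly Lipschitz, so on
  a totally bounded set their pointwise limit along the ultrafilter is a uniform limit.\<close>

section \<open>Ultrapowers and standard parts\<close>

lemma mem_ultra_class: "g \<in> ultra_class \<mu> f \<longleftrightarrow> eventually (\<lambda>j. f j = g j) \<mu>"
  by (simp add: ultra_class_def ultra_eq_def)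

lemma ultra_class_self: "f \<in> ultra_class \<mu> f"
  by (simp add: mem_ultra_class)

lemma ultra_class_eqI:
  assumes "eventually (\<lambda>j. f j = g j) \<mu>"
  shows "ultra_class \<mu> f = ultra_class \<mu> g"
proof (intro set_eqI)
  fix h
  show "h \<in> ultra_class \<mu> f \<longleftrightarrow> h \<in> ultra_class \<mu> g"
    unfolding mem_ultra_class using assms
    by (auto elim: eventually_elim2)
qed

lemma ultra_class_in_ultrapower: "ultra_class \<mu> f \<in> ultrapower \<mu>"
  unfolding ultrapower_def ultra_class_def by (simp add: quotientI)

lemma ultrapowerE:
  assumes "p \<in> ultrapower \<mu>"
  obtains f where "p = ultra_class \<mu> f"
  using assms unfolding ultrapower_def ultra_class_def by (auto elim: quotientE)

text \<open>Families that agree eventually along \<open>\<mu>\<close> have images that agree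
  eventually, so all classes in the defining union coincide; it is a nonempty union by
  \<open>ultra_class_self\<close>.\<close>

lemma ultra_map_class:
  "ultra_map \<mu> F (ultra_class \<mu> f) = ultra_class \<mu> (\<lambda>j. F (f j))"
proof -
  have "ultra_class \<mu> (\<lambda>j. F (g j)) = ultra_class \<mu> (\<lambda>j. F (f j))"
    if "g \<in> ultra_class \<mu> f" for g
    using that unfolding mem_ultra_class
    by (intro ultra_class_eqI) (auto elim: eventually_mono)
  then show ?thesis
    unfolding ultra_map_def using ultra_class_self[of f \<mu>] by blast
qed

lemma ultra_map2_class:
  "ultra_map2 \<mu> F (ultra_class \<mu> f) (ultra_class \<mu> g) = ultra_class \<mu> (\<lambda>j. F (f j) (g j))"
proof -
  have "ultra_class \<mu> (\<lambda>j. F (f' j) (g' j)) = ultra_class \<mu> (\<lambda>j. F (f j) (g j))"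
    if "f' \<in> ultra_class \<mu> f" "g' \<in> ultra_class \<mu> g" for f' g'
    using that unfolding mem_ultra_class
    by (intro ultra_class_eqI) (auto elim: eventually_elim2)
  then show ?thesis
    unfolding ultra_map2_def using ultra_class_self[of f \<mu>] ultra_class_self[of g \<mu>] by blast
qed

lemma ultra_rel_class:
  "ultra_rel \<mu> R (ultra_class \<mu> f) (ultra_class \<mu> g) \<longleftrightarrow> eventually (\<lambda>j. R (f j) (g j)) \<mu>"
proof
  assume "ultra_rel \<mu> R (ultra_class \<mu> f) (ultra_class \<mu> g)"
  then obtain f' g' where "eventually (\<lambda>j. f j = f' j) \<mu>" "eventually (\<lambda>j. g j = g' j) \<mu>"
    "eventually (\<lambda>j. R (f' j) (g' j)) \<mu>"
    unfolding ultra_rel_def by (auto simp: mem_ultra_class)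
  then show "eventually (\<lambda>j. R (f j) (g j)) \<mu>"
    by eventually_elim simp
next
  assume "eventually (\<lambda>j. R (f j) (g j)) \<mu>"
  then show "ultra_rel \<mu> R (ultra_class \<mu> f) (ultra_class \<mu> g)"
    unfolding ultra_rel_def using ultra_class_self[of f \<mu>] ultra_class_self[of g \<mu>] by blast
qed

lemma hyper_fin_class:
  "ultra_class \<mu> f \<in> hyper_fin \<mu> \<longleftrightarrow> (\<exists>n::nat. eventually (\<lambda>j. \<bar>f j\<bar> \<le> real n) \<mu>)"
  by (simp add: hyper_fin_def ultra_const_def ultra_map_class ultra_rel_class
      ultra_class_in_ultrapower)

text \<open>Translates infinitesimals into convergence along a filter, so that the later arguments
  can use limits in place of hyperreals. The bounds \<open>1 / 2 ^ n\<close> get below every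
  positive tolerance.\<close>

lemma hyper_inf_class:
  "ultra_class \<mu> f \<in> hyper_inf \<mu> \<longleftrightarrow> (f \<longlongrightarrow> 0) \<mu>"
proof -
  have "ultra_class \<mu> f \<in> hyper_inf \<mu> \<longleftrightarrow> (\<forall>n::nat. eventually (\<lambda>j. \<bar>f j\<bar> \<le> 1 / 2 ^ n) \<mu>)"
    by (simp add: hyper_inf_def ultra_const_def ultra_map_class ultra_rel_class
        ultra_class_in_ultrapower)
  also have "\<dots> \<longleftrightarrow> (f \<longlongrightarrow> 0) \<mu>"
  proof
    assume small: "\<forall>n::nat. eventually (\<lambda>j. \<bar>f j\<bar> \<le> 1 / 2 ^ n) \<mu>"
    show "(f \<longlongrightarrow> 0) \<mu>"
    proof (rule tendstoI)
      fix e :: real assume "e > 0"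
      then obtain n where "(1 / 2) ^ n < e"
        using real_arch_pow_inv[of e "1 / 2"] by auto
      then show "eventually (\<lambda>j. dist (f j) 0 < e) \<mu>"
        using small[rule_format, of n]
        by (auto simp: power_one_over elim: eventually_mono)
    qed
  next
    assume "(f \<longlongrightarrow> 0) \<mu>"
    then have "eventually (\<lambda>j. \<bar>f j\<bar> < 1 / 2 ^ n) \<mu>" for n :: nat
      using tendstoD[of f 0 \<mu> "1 / 2 ^ n"] by simp
    then show "\<forall>n::nat. eventually (\<lambda>j. \<bar>f j\<bar> \<le> 1 / 2 ^ n) \<mu>"
      using eventually_mono less_imp_le by (metis (mono_tags, lifting))
  qed
  finally show ?thesis .
qed

text \<open>A convergent family is eventually bounded, hence finite, and subtracting its limit
  leaves an infinitesimal. Uniqueness of limits along a proper filter makes the description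
  definite.\<close>

lemma std_part_class:
  assumes "\<mu> \<noteq> bot" and "(f \<longlongrightarrow> L) \<mu>"
  shows "std_part \<mu> (ultra_class \<mu> f) = L"
  unfolding std_part_def
proof (rule the_equality)
  obtain n :: nat where n: "\<bar>L\<bar> + 1 \<le> real n"
    using real_arch_simple by blast
  have "eventually (\<lambda>j. dist (f j) L < 1) \<mu>"
    using assms(2) by (rule tendstoD) simp
  then have "eventually (\<lambda>j. \<bar>f j\<bar> \<le> real n) \<mu>"
    by eventually_elim (use n in \<open>auto simp: dist_real_def\<close>)
  then show "ultra_class \<mu> f \<in> hyper_fin \<mu> \<and>
      hyper_minus \<mu> (ultra_class \<mu> f) (ultra_const \<mu> L) \<in> hyper_inf \<mu>"
    using assms(2) Lim_null[of f L \<mu>]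
    by (auto simp: hyper_fin_class ultra_const_def ultra_map2_class hyper_inf_class)
next
  fix s
  assume "ultra_class \<mu> f \<in> hyper_fin \<mu> \<and>
      hyper_minus \<mu> (ultra_class \<mu> f) (ultra_const \<mu> s) \<in> hyper_inf \<mu>"
  then have "(f \<longlongrightarrow> s) \<mu>"
    using Lim_null[of f s \<mu>] by (simp add: ultra_const_def ultra_map2_class hyper_inf_class)
  then show "s = L"
    using assms tendsto_unique by blast
qed

lemma horo_class:
  assumes "\<mu> \<noteq> bot" and "((\<lambda>j. \<delta> (f j) x - \<delta> (f j) b) \<longlongrightarrow> L) \<mu>"
  shows "horo \<mu> \<delta> b (ultra_class \<mu> f) x = L"
  using std_part_class[OF assms] by (simp add: horo_def ultra_const_def ultra_map2_class)

text \<open>Compactness gives a cluster point \<open>L\<close> of the image filter. For an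
  ultrafilter a cluster point is a limit: if \<open>f\<close> were not eventually in a neighbourhood
  of \<open>L\<close>, it would eventually be in the complement.\<close>

lemma free_ultrafilter_compact_limit:
  assumes "free_ultrafilter \<mu>" and "compact K" and "eventually (\<lambda>j. f j \<in> K) \<mu>"
  shows "\<exists>L\<in>K. (f \<longlongrightarrow> L) \<mu>"
proof -
  have "filtermap f \<mu> \<noteq> bot"
    using assms(1) by (simp add: free_ultrafilter_def filtermap_bot_iff)
  then obtain L where L: "L \<in> K" "inf (nhds L) (filtermap f \<mu>) \<noteq> bot"
    using assms(2,3) unfolding compact_filter by (auto simp: eventually_filtermap)
  have "(f \<longlongrightarrow> L) \<mu>"
  proof (rule topological_tendstoI, rule ccontr)
    fix S assume S: "open S" "L \<in> S" and "\<not> eventually (\<lambda>j. f j \<in> S) \<mu>"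
    then have "eventually (\<lambda>j. f j \<notin> S) \<mu>"
      using assms(1) unfolding free_ultrafilter_def by blast
    \<comment> \<open>\<open>S\<close> belongs to the neighbourhood filter of \<open>L\<close> and
      its complement to the image filter, so their infimum would be trivial.\<close>
    then have "eventually (\<lambda>_. False) (inf (nhds L) (filtermap f \<mu>))"
      unfolding eventually_inf
      using S by (intro exI[of _ "\<lambda>y. y \<in> S"] exI[of _ "\<lambda>y. y \<notin> S"])
        (auto simp: eventually_filtermap eventually_nhds)
    then show False
      using L(2) by (simp add: trivial_limit_def)
  qed
  with L(1) show ?thesis by blast
qed

lemma free_ultrafilter_cofinite:
  assumes "free_ultrafilter \<mu>" and "finite A"
  shows "eventually (\<lambda>j. j \<notin> A) \<mu>"
proof -
  have "eventually (\<lambda>j. \<forall>i\<in>A. j \<noteq> i) \<mu>"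
    using assms by (auto simp: free_ultrafilter_def intro: eventually_ball_finite)
  then show ?thesis by (auto elim: eventually_mono)
qed

section \<open>The closure in the space of functions modulo constants\<close>

lemma C_Bnd_lipschitz:
  fixes \<phi> :: "'a::metric_space \<Rightarrow> real"
  assumes "\<And>x y. \<bar>\<phi> x - \<phi> y\<bar> \<le> C * dist x y"
  shows "\<phi> \<in> C_Bnd"
proof -
  \<comment> \<open>The sign of \<open>C\<close> is not given, whereas \<open>lipschitz_on\<close>
    demands a nonnegative constant.\<close>
  have abs_le: "\<bar>\<phi> x - \<phi> y\<bar> \<le> \<bar>C\<bar> * dist x y" for x y
    using order_trans[OF assms mult_right_mono[OF abs_ge_self zero_le_dist]] .
  then have lip: "\<bar>C\<bar>-lipschitz_on UNIV \<phi>"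
    by (intro lipschitz_onI) (auto simp: dist_real_def)
  have "bounded (\<phi> ` B)" if B: "bounded B" for B
  proof -
    obtain a e where "\<forall>x\<in>B. dist a x \<le> e"
      using B unfolding bounded_def by blast
    then have "\<bar>\<phi> a - \<phi> x\<bar> \<le> \<bar>C\<bar> * e" if "x \<in> B" for x
      using that abs_le[of a x]
      by (meson abs_ge_zero mult_left_mono order_trans)
    then show ?thesis
      unfolding bounded_def by (auto simp: dist_real_def)
  qed
  then show ?thesis
    using lipschitz_on_continuous_on[OF lip] by (simp add: C_Bnd_def)
qed

lemma C_Bnd_diff_const:
  assumes "\<phi> \<in> C_Bnd"
  shows "(\<lambda>x. \<phi> x - c) \<in> C_Bnd"
proof -
  have "bounded ((\<lambda>x. \<phi> x - c) ` B)" if "bounded B" for B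
    using assms that bounded_translation_minus[of "\<phi> ` B" c]
    by (auto simp: C_Bnd_def image_image)
  then show ?thesis
    using assms by (auto simp: C_Bnd_def intro!: continuous_intros)
qed

lemma equiv_mod_const: "equiv C_Bnd (mod_const :: (('a::metric_space \<Rightarrow> real) \<times> ('a \<Rightarrow> real)) set)"
  (is "equiv _ ?R")
proof (rule equivI)
  show "sym ?R"
  proof (rule symI)
    fix \<phi> \<psi> :: "'a \<Rightarrow> real" assume "(\<phi>, \<psi>) \<in> mod_const"
    then obtain c where "\<phi> \<in> C_Bnd" "\<psi> \<in> C_Bnd" "\<forall>x. \<psi> x = \<phi> x + c"
      unfolding mod_const_def by auto
    then show "(\<psi>, \<phi>) \<in> mod_const"
      unfolding mod_const_def by (auto intro!: exI[of _ "- c"])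
  qed
  show "trans ?R"
  proof (rule transI)
    fix \<phi> \<psi> \<eta> :: "'a \<Rightarrow> real" assume "(\<phi>, \<psi>) \<in> mod_const" "(\<psi>, \<eta>) \<in> mod_const"
    then obtain c c' where "\<phi> \<in> C_Bnd" "\<eta> \<in> C_Bnd" "\<forall>x. \<psi> x = \<phi> x + c" "\<forall>x. \<eta> x = \<psi> x + c'"
      unfolding mod_const_def by auto
    then show "(\<phi>, \<eta>) \<in> mod_const"
      unfolding mod_const_def by (auto intro!: exI[of _ "c + c'"])
  qed
qed (auto simp: refl_on_def mod_const_def intro!: exI[of _ 0])

lemma const_class_eq_iff:
  assumes "\<phi> \<in> C_Bnd" and "\<psi> \<in> C_Bnd"
  shows "const_class \<phi> = const_class \<psi> \<longleftrightarrow> (\<exists>c. \<forall>x. \<psi> x = \<phi> x + c)"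
  using assms eq_equiv_class_iff[OF equiv_mod_const assms]
  by (simp add: const_class_def mod_const_def)

text \<open>The whole quotient is open because its preimage is all of \<open>C_Bnd\<close>, so every
  class lies in the carrier of the topology.\<close>

lemma const_class_in_topspace:
  assumes "\<phi> \<in> C_Bnd"
  shows "const_class \<phi> \<in> topspace C_Bnd_mod_const"
proof -
  have class_in: "const_class \<psi> \<in> C_Bnd // mod_const" if "\<psi> \<in> C_Bnd" for \<psi> :: "'a \<Rightarrow> real"
    using that by (simp add: const_class_def quotientI)
  have "openin C_Bnd_topology (C_Bnd :: ('a \<Rightarrow> real) set)"
    unfolding openin_C_Bnd_topology by (auto intro!: exI[of _ "{}"] exI[of _ "1::real"])
  moreover have "{\<psi> \<in> C_Bnd. const_class \<psi> \<in> C_Bnd // mod_const} = (C_Bnd :: ('a \<Rightarrow> real) set)"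
    using class_in by blast
  ultimately have "openin C_Bnd_mod_const ((C_Bnd :: ('a \<Rightarrow> real) set) // mod_const)"
    by (simp add: openin_C_Bnd_mod_const)
  then show ?thesis
    using class_in[OF assms] openin_subset by blast
qed

text \<open>The bound \<open>e < \<epsilon>\<close> has to be uniform: the pointwise strict inequality does not define an
  open set for uniform convergence.\<close>

lemma openin_normalized_nbhd:
  fixes \<phi> :: "'a::metric_space \<Rightarrow> real"
  assumes "bounded B"
  shows "openin C_Bnd_mod_const
    {const_class \<psi> | \<psi>. \<psi> \<in> C_Bnd \<and> (\<exists>e<\<epsilon>. \<forall>x\<in>B. \<bar>\<psi> x - \<psi> b - \<phi> x\<bar> \<le> e)}"
    (is "openin _ ?V")
proof -
  define W where "W = {\<psi> \<in> C_Bnd. \<exists>e<\<epsilon>. \<forall>x\<in>B. \<bar>\<psi> x - \<psi> b - \<phi> x\<bar> \<le> e}"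
  have "{\<psi> \<in> C_Bnd. const_class \<psi> \<in> ?V} = W"
  proof (intro equalityI subsetI)
    fix \<psi> assume "\<psi> \<in> {\<psi> \<in> C_Bnd. const_class \<psi> \<in> ?V}"
    then obtain \<eta> where \<eta>: "\<psi> \<in> C_Bnd" "\<eta> \<in> C_Bnd" "const_class \<psi> = const_class \<eta>"
      "\<exists>e<\<epsilon>. \<forall>x\<in>B. \<bar>\<eta> x - \<eta> b - \<phi> x\<bar> \<le> e"
      by auto
    then obtain c where "\<forall>x. \<eta> x = \<psi> x + c"
      by (auto simp: const_class_eq_iff)
    \<comment> \<open>The constant \<open>c\<close> cancels in \<open>\<eta> x - \<eta> b\<close>;
      hence \<open>W\<close> is a union of full classes.\<close>
    then show "\<psi> \<in> W"
      using \<eta> by (simp add: W_def)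
  qed (auto simp: W_def)
  moreover have "openin C_Bnd_topology W"
    unfolding openin_C_Bnd_topology
  proof (intro conjI ballI)
    fix \<psi> assume "\<psi> \<in> W"
    then obtain e where e: "e < \<epsilon>" "\<forall>x\<in>B. \<bar>\<psi> x - \<psi> b - \<phi> x\<bar> \<le> e"
      by (auto simp: W_def)
    \<comment> \<open>Normalizing at \<open>b\<close> costs one error at \<open>x\<close> and one at
      \<open>b\<close>, so \<open>b\<close> joins the bounded set. Two errors of
      \<open>(\<epsilon> - e) / 4\<close> raise the bound \<open>e\<close> to the midpoint
      \<open>(\<epsilon> + e) / 2\<close>, which is still below \<epsilon>.\<close>
    have "\<eta> \<in> W" if \<eta>: "\<eta> \<in> C_Bnd" "\<forall>x\<in>insert b B. \<bar>\<eta> x - \<psi> x\<bar> < (\<epsilon> - e) / 4" for \<eta>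
    proof -
      have "\<bar>\<eta> x - \<eta> b - \<phi> x\<bar> \<le> (\<epsilon> + e) / 2" if "x \<in> B" for x
      proof -
        have "\<bar>\<eta> x - \<psi> x\<bar> < (\<epsilon> - e) / 4" "\<bar>\<eta> b - \<psi> b\<bar> < (\<epsilon> - e) / 4" "\<bar>\<psi> x - \<psi> b - \<phi> x\<bar> \<le> e"
          using \<eta>(2) e(2) that by auto
        then show ?thesis
          unfolding abs_le_iff abs_less_iff by (simp add: field_simps)
      qed
      moreover have "(\<epsilon> + e) / 2 < \<epsilon>" using e(1) by simp
      ultimately show ?thesis using \<eta>(1) unfolding W_def by blast
    qed
    then show "\<exists>B \<epsilon>. bounded B \<and> \<epsilon> > 0 \<and> {\<eta> \<in> C_Bnd. \<forall>x\<in>B. \<bar>\<eta> x - \<psi> x\<bar> < \<epsilon>} \<subseteq> W"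
      using e(1) assms by (intro exI[of _ "insert b B"] exI[of _ "(\<epsilon> - e) / 4"]) auto
  qed (auto simp: W_def)
  moreover have "?V \<subseteq> C_Bnd // mod_const"
    by (auto simp: const_class_def quotientI)
  ultimately show ?thesis
    by (simp add: openin_C_Bnd_mod_const)
qed

text \<open>Unfolds the closure in the quotient into uniform approximation on bounded sets. One
  direction tests the closure against the neighbourhoods of \<open>openin_normalized_nbhd\<close>,
  the other pulls an open set of classes back to \<open>C_Bnd\<close>.\<close>

lemma normalized_horofunction_iff:
  fixes \<delta> :: "'a::metric_space \<Rightarrow> 'a \<Rightarrow> real"
  assumes "\<And>p. \<delta> p \<in> C_Bnd"
  shows "normalized_horofunction \<delta> b \<phi> \<longleftrightarrow> \<phi> \<in> C_Bnd \<and> \<phi> b = 0 \<and>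
    (\<forall>B \<epsilon>. bounded B \<and> \<epsilon> > 0 \<longrightarrow> (\<exists>p. \<forall>x\<in>B. \<bar>\<delta> p x - \<delta> p b - \<phi> x\<bar> < \<epsilon>))"
    (is "_ \<longleftrightarrow> _ \<and> _ \<and> ?approx")
proof (cases "\<phi> \<in> C_Bnd \<and> \<phi> b = 0")
  case True
  then have \<phi>: "\<phi> \<in> C_Bnd" "\<phi> b = 0" by auto
  have "const_class \<phi> \<in> bordification \<delta> \<longleftrightarrow> ?approx"
  proof
    assume cl: "const_class \<phi> \<in> bordification \<delta>"
    show ?approx
    proof (intro allI impI, elim conjE)
      fix B :: "'a set" and \<epsilon> :: real assume B: "bounded B" and \<epsilon>: "\<epsilon> > 0"
      let ?V = "{const_class \<psi> | \<psi>. \<psi> \<in> C_Bnd \<and> (\<exists>e<\<epsilon>. \<forall>x\<in>B. \<bar>\<psi> x - \<psi> b - \<phi> x\<bar> \<le> e)}"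
      have "const_class \<phi> \<in> ?V"
        using \<phi> \<epsilon> by (auto intro!: exI[of _ \<phi>] exI[of _ "0::real"])
      then have "\<exists>\<Psi>. \<Psi> \<in> {const_class (\<delta> p) | p. True} \<and> \<Psi> \<in> ?V"
        using cl[unfolded bordification_def in_closure_of, THEN conjunct2, THEN spec, of ?V]
          openin_normalized_nbhd[OF B, of \<epsilon> b \<phi>] by (metis (no_types, lifting))
      then obtain p \<psi> e where \<psi>: "const_class (\<delta> p) = const_class \<psi>" "\<psi> \<in> C_Bnd" "e < \<epsilon>"
        "\<forall>x\<in>B. \<bar>\<psi> x - \<psi> b - \<phi> x\<bar> \<le> e"
        by force
      then obtain c where "\<forall>x. \<psi> x = \<delta> p x + c"
        using assms by (auto simp: const_class_eq_iff)
      \<comment> \<open>Normalizing at \<open>b\<close> removes \<open>c\<close>, and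
        \<open>e < \<epsilon>\<close> makes the bound strict.\<close>
      then have "\<forall>x\<in>B. \<bar>\<delta> p x - \<delta> p b - \<phi> x\<bar> < \<epsilon>"
        using \<psi> by fastforce
      then show "\<exists>p. \<forall>x\<in>B. \<bar>\<delta> p x - \<delta> p b - \<phi> x\<bar> < \<epsilon>" ..
    qed
  next
    assume approx: ?approx
    show "const_class \<phi> \<in> bordification \<delta>"
      unfolding bordification_def in_closure_of
    proof (intro conjI allI impI)
      show "const_class \<phi> \<in> topspace C_Bnd_mod_const"
        using \<phi>(1) by (rule const_class_in_topspace)
      fix V :: "('a \<Rightarrow> real) set set"
      assume V: "const_class \<phi> \<in> V \<and> openin C_Bnd_mod_const V"
      then obtain B \<epsilon> where B: "bounded B" "\<epsilon> > 0"
        "{\<psi> \<in> C_Bnd. \<forall>x\<in>B. \<bar>\<psi> x - \<phi> x\<bar> < \<epsilon>} \<subseteq> {\<psi> \<in> C_Bnd. const_class \<psi> \<in> V}"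
        using \<phi>(1) unfolding openin_C_Bnd_mod_const openin_C_Bnd_topology by blast
      then obtain p where p: "\<forall>x\<in>B. \<bar>\<delta> p x - \<delta> p b - \<phi> x\<bar> < \<epsilon>"
        using approx by blast
      \<comment> \<open>The normalized function is the one close to \<open>\<phi>\<close>; it
        represents the same class as \<open>\<delta> p\<close>.\<close>
      have mem: "(\<lambda>x. \<delta> p x - \<delta> p b) \<in> C_Bnd"
        by (intro C_Bnd_diff_const assms)
      then have "const_class (\<lambda>x. \<delta> p x - \<delta> p b) \<in> V"
        using B(3) p by auto
      moreover have "const_class (\<lambda>x. \<delta> p x - \<delta> p b) = const_class (\<delta> p)"
        using mem assms by (subst const_class_eq_iff) auto
      ultimately show "\<exists>\<psi>. \<psi> \<in> {const_class (\<delta> p) | p. True} \<and> \<psi> \<in> V"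
        by auto
    qed
  qed
  with True show ?thesis by (simp add: normalized_horofunction_def)
qed (auto simp: normalized_horofunction_def)

section \<open>Horofunctions as ultralimits\<close>

text \<open>The triangle inequality is used once with \<open>\<delta> y x\<close> and once with
  \<open>\<delta> x y\<close>; both are bounded by the same symmetric quantity
  \<open>\<beta> * dist x y\<close>.\<close>

lemma asymmetric_metric_lipschitz:
  assumes "asymmetric_metric \<delta>" and "\<And>p q. \<delta> p q \<le> \<beta> * dist p q"
  shows "\<bar>\<delta> p x - \<delta> p y\<bar> \<le> \<beta> * dist x (y::'a::metric_space)"
proof -
  have "\<delta> p x \<le> \<delta> p y + \<delta> y x" "\<delta> p y \<le> \<delta> p x + \<delta> x y"
    using assms(1) by (auto simp: asymmetric_metric_def)
  then show ?thesis
    using assms(2)[of x y] assms(2)[of y x] by (simp add: dist_commute abs_le_iff)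
qed

lemma horofunction_is_horo:
  fixes \<phi> :: "'a::metric_space \<Rightarrow> real" and \<mu> :: "'j filter"
  assumes "countable (UNIV :: 'j set)" and \<mu>: "free_ultrafilter \<mu>"
    and approx: "\<And>B \<epsilon>. bounded B \<Longrightarrow> \<epsilon> > 0 \<Longrightarrow> \<exists>p. \<forall>x\<in>B. \<bar>\<delta> p x - \<delta> p b - \<phi> x\<bar> < \<epsilon>"
  shows "\<exists>p\<in>ultrapower \<mu>. \<phi> = horo \<mu> \<delta> b p"
proof -
  have "\<forall>n::nat. \<exists>p. \<forall>x\<in>cball b (real n). \<bar>\<delta> p x - \<delta> p b - \<phi> x\<bar> < 1 / real (Suc n)"
    by (intro allI approx) auto
  then obtain q where q:
    "\<And>n x. x \<in> cball b (real n) \<Longrightarrow> \<bar>\<delta> (q n) x - \<delta> (q n) b - \<phi> x\<bar> < 1 / real (Suc n)"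
    by metis
  \<comment> \<open>The index set is only countable, so an injection into the naturals decides which
    approximation \<open>q n\<close> is placed at \<open>j\<close>. Injectivity makes each set of
    indices with \<open>\<iota> j < N\<close> finite.\<close>
  define \<iota> :: "'j \<Rightarrow> nat" where "\<iota> = to_nat_on UNIV"
  have inj: "inj \<iota>"
    using assms(1) by (simp add: \<iota>_def inj_on_to_nat_on)
  have \<iota>_large: "eventually (\<lambda>j. N \<le> \<iota> j) \<mu>" for N
  proof -
    have "finite (\<iota> -` {..<N})"
      using inj by (simp add: finite_vimageI)
    then have "eventually (\<lambda>j. j \<notin> \<iota> -` {..<N}) \<mu>"
      by (rule free_ultrafilter_cofinite[OF \<mu>])
    then show ?thesis by (auto elim: eventually_mono)
  qed
  have "((\<lambda>j. \<delta> (q (\<iota> j)) x - \<delta> (q (\<iota> j)) b) \<longlongrightarrow> \<phi> x) \<mu>" for x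
  proof (rule tendstoI)
    fix e :: real assume "e > 0"
    then obtain N where N: "1 / real (Suc N) < e"
      using nat_approx_posE by blast
    obtain M :: nat where M: "dist b x \<le> real M"
      using real_arch_simple by blast
    \<comment> \<open>\<open>N\<close> secures the precision \<open>e\<close>, and \<open>M\<close>
      ensures that \<open>x\<close> lies in the ball on which the approximation holds.\<close>
    show "eventually (\<lambda>j. dist (\<delta> (q (\<iota> j)) x - \<delta> (q (\<iota> j)) b) (\<phi> x) < e) \<mu>"
      using \<iota>_large[of "max N M"]
    proof eventually_elim
      case (elim j)
      then have "x \<in> cball b (real (\<iota> j))" "1 / real (Suc (\<iota> j)) \<le> 1 / real (Suc N)"
        using M by (auto simp: frac_le)
      then show ?case
        using q[of x "\<iota> j"] N by (simp add: dist_real_def)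
    qed
  qed
  then have "\<phi> = horo \<mu> \<delta> b (ultra_class \<mu> (q \<circ> \<iota>))"
    using \<mu> by (auto simp: free_ultrafilter_def intro!: horo_class[symmetric])
  then show ?thesis
    using ultra_class_in_ultrapower by blast
qed

text \<open>For fixed \<open>x\<close> the Lipschitz bound confines all normalized differences to
  one compact interval, so an ultrafilter limit exists, and \<open>horo_class\<close> identifies
  it.\<close>

lemma horo_tendsto:
  fixes \<delta> :: "'a::metric_space \<Rightarrow> 'a \<Rightarrow> real"
  assumes \<mu>: "free_ultrafilter \<mu>" and lip: "\<And>p x y. \<bar>\<delta> p x - \<delta> p y\<bar> \<le> \<beta> * dist x y"
  shows "((\<lambda>j. \<delta> (f j) x - \<delta> (f j) b) \<longlongrightarrow> horo \<mu> \<delta> b (ultra_class \<mu> f) x) \<mu>"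
proof -
  have "\<delta> (f j) x - \<delta> (f j) b \<in> {- (\<beta> * dist x b)..\<beta> * dist x b}" for j
    using lip[of "f j" x b] by auto
  then obtain L where "((\<lambda>j. \<delta> (f j) x - \<delta> (f j) b) \<longlongrightarrow> L) \<mu>"
    using free_ultrafilter_compact_limit[OF \<mu> compact_Icc] by (meson always_eventually)
  moreover from this have "horo \<mu> \<delta> b (ultra_class \<mu> f) x = L"
    using \<mu> by (intro horo_class) (auto simp: free_ultrafilter_def)
  ultimately show ?thesis by simp
qed

text \<open>The terms at \<open>b\<close> cancel in the difference, so every member of the family
  obeys the bound with the same \<beta>, and a non-strict bound survives the limit.\<close>

lemma horo_lipschitz:
  fixes \<delta> :: "'a::metric_space \<Rightarrow> 'a \<Rightarrow> real" and b :: 'a and f :: "'j \<Rightarrow> 'a"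
  assumes \<mu>: "free_ultrafilter \<mu>" and lip: "\<And>p x y. \<bar>\<delta> p x - \<delta> p y\<bar> \<le> \<beta> * dist x y"
  defines "h \<equiv> horo \<mu> \<delta> b (ultra_class \<mu> f)"
  shows "\<bar>h x - h y\<bar> \<le> \<beta> * dist x y"
proof -
  have "((\<lambda>j. \<bar>(\<delta> (f j) x - \<delta> (f j) b) - (\<delta> (f j) y - \<delta> (f j) b)\<bar>) \<longlongrightarrow> \<bar>h x - h y\<bar>) \<mu>"
    unfolding h_def by (intro tendsto_intros horo_tendsto[OF \<mu> lip])
  moreover have "\<mu> \<noteq> bot"
    using \<mu> by (simp add: free_ultrafilter_def)
  ultimately show ?thesis
    using lip by (auto intro: tendsto_upperbound)
qed

text \<open>Pointwise convergence on a finite net, together with the common Lipschitz constant,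
  yields uniform closeness on \<open>B\<close>. A single member \<open>f j\<close> of the family
  serves as \<open>p\<close>.\<close>

lemma horo_approx:
  fixes \<delta> :: "'a::metric_space \<Rightarrow> 'a \<Rightarrow> real" and b :: 'a and f :: "'j \<Rightarrow> 'a"
  assumes \<mu>: "free_ultrafilter \<mu>" and lip: "\<And>p x y. \<bar>\<delta> p x - \<delta> p y\<bar> \<le> \<beta> * dist x y"
    and \<beta>: "\<beta> > 0" and B: "totally_bounded B" and \<epsilon>: "\<epsilon> > 0"
  defines "h \<equiv> horo \<mu> \<delta> b (ultra_class \<mu> f)"
  shows "\<exists>p. \<forall>x\<in>B. \<bar>\<delta> p x - \<delta> p b - h x\<bar> < \<epsilon>"
proof -
  \<comment> \<open>With this radius, moving from \<open>x\<close> to a net point changes each of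
    the two Lipschitz functions by less than \<open>\<epsilon> / 3\<close>, leaving a third for the
    error at the net point.\<close>
  define r where "r = \<epsilon> / (3 * \<beta>)"
  have "r > 0" using \<epsilon> \<beta> by (simp add: r_def)
  then obtain Y where Y: "finite Y" "B \<subseteq> (\<Union>y\<in>Y. ball y r)"
    using B unfolding totally_bounded_metric ball_def by meson
  have "eventually (\<lambda>j. \<forall>y\<in>Y. dist (\<delta> (f j) y - \<delta> (f j) b) (h y) < \<epsilon> / 3) \<mu>"
    using Y(1)
  proof (rule eventually_ball_finite, intro ballI)
    fix y
    show "eventually (\<lambda>j. dist (\<delta> (f j) y - \<delta> (f j) b) (h y) < \<epsilon> / 3) \<mu>"
      unfolding h_def using horo_tendsto[OF \<mu> lip] by (rule tendstoD) (use \<epsilon> in simp)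
  qed
  moreover have "\<mu> \<noteq> bot"
    using \<mu> by (simp add: free_ultrafilter_def)
  \<comment> \<open>An event of a proper filter is nonempty, so an actual index can be chosen that
    works for all net points at once.\<close>
  ultimately obtain j where j: "\<forall>y\<in>Y. dist (\<delta> (f j) y - \<delta> (f j) b) (h y) < \<epsilon> / 3"
    using eventually_happens' by blast
  have "\<bar>\<delta> (f j) x - \<delta> (f j) b - h x\<bar> < \<epsilon>" if x: "x \<in> B" for x
  proof -
    obtain y where y: "y \<in> Y" "dist x y < r"
      using subsetD[OF Y(2) x] by (auto simp: dist_commute)
    have "\<beta> * dist x y < \<epsilon> / 3"
      using y(2) \<beta> by (simp add: r_def field_simps)
    moreover have "\<bar>\<delta> (f j) x - \<delta> (f j) y\<bar> \<le> \<beta> * dist x y"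
      by (rule lip)
    moreover have "\<bar>h x - h y\<bar> \<le> \<beta> * dist x y"
      unfolding h_def by (rule horo_lipschitz[OF \<mu> lip])
    moreover have "\<bar>\<delta> (f j) y - \<delta> (f j) b - h y\<bar> < \<epsilon> / 3"
      using j y(1) by (simp add: dist_real_def)
    ultimately show ?thesis by linarith
  qed
  then show ?thesis by blast
qed

theorem theorem5p2:
  fixes \<delta> :: "'a::metric_space \<Rightarrow> 'a \<Rightarrow> real"
    and b :: 'a
    and \<mu> :: "'j filter"
  assumes "countable (UNIV :: 'j set)" and "infinite (UNIV :: 'j set)"
    and "free_ultrafilter \<mu>"
    and "asymmetric_metric \<delta>"
    and "property_bL \<delta>"
    and "property_ic \<delta>"
  shows "(\<forall>\<phi>. normalized_horofunction \<delta> b \<phi> \<longrightarrow> (\<exists>p\<in>ultrapower \<mu>. \<phi> = horo \<mu> \<delta> b p)) \<and>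
    (almost_proper TYPE('a) \<longrightarrow>
       (\<forall>p\<in>ultrapower \<mu>. normalized_horofunction \<delta> b (horo \<mu> \<delta> b p)))"
proof -
  obtain \<beta> where \<beta>: "\<beta> > 0" and \<delta>_le: "\<And>p q. \<delta> p q \<le> \<beta> * dist p q"
    using assms(5) unfolding property_bL_def by blast
  \<comment> \<open>The upper bound in (bL) gives a Lipschitz constant that does not depend on
    \<open>p\<close>; both directions rest on this uniformity.\<close>
  have lip: "\<bar>\<delta> p x - \<delta> p y\<bar> \<le> \<beta> * dist x y" for p x y
    using assms(4) \<delta>_le by (rule asymmetric_metric_lipschitz)
  have C_Bnd: "\<delta> p \<in> C_Bnd" for p
    using lip by (rule C_Bnd_lipschitz)
  show ?thesis
  proof (intro conjI allI impI ballI)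
    fix \<phi> assume "normalized_horofunction \<delta> b \<phi>"
    then show "\<exists>p\<in>ultrapower \<mu>. \<phi> = horo \<mu> \<delta> b p"
      unfolding normalized_horofunction_iff[of \<delta>, OF C_Bnd]
      by (intro horofunction_is_horo assms(1,3)) auto
  next
    fix p :: "('j \<Rightarrow> 'a) set" assume proper: "almost_proper TYPE('a)" and "p \<in> ultrapower \<mu>"
    then obtain f where p: "p = ultra_class \<mu> f"
      using ultrapowerE by blast
    have "horo \<mu> \<delta> b p \<in> C_Bnd"
      unfolding p using horo_lipschitz[OF assms(3) lip] by (rule C_Bnd_lipschitz)
    \<comment> \<open>At the base point the family of differences is constantly 0.\<close>
    moreover have "horo \<mu> \<delta> b p b = 0"
      unfolding p using assms(3) by (intro horo_class) (auto simp: free_ultrafilter_def)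
    moreover have "\<exists>q. \<forall>x\<in>B. \<bar>\<delta> q x - \<delta> q b - horo \<mu> \<delta> b p x\<bar> < \<epsilon>"
      if "bounded B" "\<epsilon> > 0" for B \<epsilon>
      unfolding p using that proper
      by (intro horo_approx[OF assms(3) lip \<beta>]) (auto simp: almost_proper_def)
    ultimately show "normalized_horofunction \<delta> b (horo \<mu> \<delta> b p)"
      unfolding normalized_horofunction_iff[of \<delta>, OF C_Bnd] by blast
  qed
qed

end
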